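(* Let $(\Omega,\mathcal{A},\mu)$ be a measure space with $\mu(\Omega)=1$, let $\mathcal{B}_1,\mathcal{B}_2\subset\mathcal{A}$ be $\sigma$-subalgebras, and let $\mathbb{E}_j\colon L_1(\mu)\to L_1(\mu)$ be the conditional expectation operator onto the $\mathcal{B}_j$-measurable functions ($j=1,2$). Let $C_j$ be the space of measurable scalar valued functions $x$ on $(\Omega,\mu)$ such that $\|x\|_{C_j}=\|\mathbb{E}_j(|x|)\|_\infty<\infty$. For a measurable scalar valued function $x$ on $\Omega$ consider the condition $$( * )\qquad\int_{E_1\cap E_2}|x|\,d\mu\le\mu(E_1)+\mu(E_2)\quad\text{for all }E_1\in\mathcal{B}_1,\ E_2\in\mathcal{B}_2.$$ If $x\in C_1+C_2$ and $\|x\|_{C_1+C_2}\le1$, then $( * )$ holds. Conversely, if $( * )$ holds, then $x\in C_1+C_2$ and $\|x\|_{C_1+C_2}\le2$.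
   Context: The norm on the sum is $\|x\|_{C_1+C_2}=\inf\{\|x_1\|_{C_1}+\|x_2\|_{C_2} : x=x_1+x_2,\ x_1\in C_1,\ x_2\in C_2\}$. *)

theory Defs
  imports "HOL-Probability.Probability"
begin

(* A sigma-subalgebra is given by a measure B with "subalgebra M B"; only its space and
   its sets matter, its measure is ignored by real_cond_exp. *)

definition Linf_norm :: "'a measure \<Rightarrow> ('a \<Rightarrow> real) \<Rightarrow> ereal" where
  "Linf_norm M f = esssup M (\<lambda>\<omega>. ereal \<bar>f \<omega>\<bar>)"

(* The conditional expectation is an operator on L_1, and real_cond_exp takes arbitrary values
   outside L_1; so the norm is set to infinity when |x| is not integrable. *)
definition C_norm :: "'a measure \<Rightarrow> 'a measure \<Rightarrow> ('a \<Rightarrow> 'b::real_normed_field) \<Rightarrow> ereal" where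
  "C_norm M B x =
     (if integrable M (\<lambda>\<omega>. norm (x \<omega>))
      then Linf_norm M (real_cond_exp M B (\<lambda>\<omega>. norm (x \<omega>)))
      else \<infinity>)"

definition C_space :: "'a measure \<Rightarrow> 'a measure \<Rightarrow> ('a \<Rightarrow> 'b::real_normed_field) set" where
  "C_space M B = {x \<in> borel_measurable M. C_norm M B x < \<infinity>}"

(* Functions are identified when they agree almost everywhere. *)
definition C_decomps ::
  "'a measure \<Rightarrow> 'a measure \<Rightarrow> 'a measure \<Rightarrow> ('a \<Rightarrow> 'b::real_normed_field)
     \<Rightarrow> (('a \<Rightarrow> 'b) \<times> ('a \<Rightarrow> 'b)) set" where
  "C_decomps M B1 B2 x =
     {(x1, x2). x1 \<in> C_space M B1 \<and> x2 \<in> C_space M B2 \<and> (AE \<omega> in M. x \<omega> = x1 \<omega> + x2 \<omega>)}"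

definition C_sum ::
  "'a measure \<Rightarrow> 'a measure \<Rightarrow> 'a measure \<Rightarrow> ('a \<Rightarrow> 'b::real_normed_field) set" where
  "C_sum M B1 B2 = {x \<in> borel_measurable M. C_decomps M B1 B2 x \<noteq> {}}"

definition C_sum_norm ::
  "'a measure \<Rightarrow> 'a measure \<Rightarrow> 'a measure \<Rightarrow> ('a \<Rightarrow> 'b::real_normed_field) \<Rightarrow> ereal" where
  "C_sum_norm M B1 B2 x =
     (INF (x1, x2) \<in> C_decomps M B1 B2 x. C_norm M B1 x1 + C_norm M B2 x2)"

(* The integral is the one with values in [0, infinity], since x is not assumed integrable. *)
definition intersection_condition ::
  "'a measure \<Rightarrow> 'a measure \<Rightarrow> 'a measure \<Rightarrow> ('a \<Rightarrow> 'b::real_normed_field) \<Rightarrow> bool" where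
  "intersection_condition M B1 B2 x \<longleftrightarrow>
     (\<forall>E1 \<in> sets B1. \<forall>E2 \<in> sets B2.
        (\<integral>\<^sup>+\<omega>\<in>E1 \<inter> E2. ennreal (norm (x \<omega>)) \<partial>M) \<le> emeasure M E1 + emeasure M E2)"

end

theory Submission
  imports Defs
begin

text \<open>
  Write $y = |x|$ and let $E_j$ be the conditional expectation onto the $j$-th subalgebra.

  If $x = x_1 + x_2$, then the integral of $y$ over $A_1 \cap A_2$ is at most the integral of
  $|x_1|$ over $A_1$ plus that of $|x_2|$ over $A_2$. Since $A_j$ belongs to the $j$-th
  subalgebra, $|x_j|$ may be replaced by $E_j |x_j|$, which is bounded by the norm of $x_j$. This is the
  first implication (\<open>set_nn_integral_le_C_norm\<close>).

  The second implication is a max-flow min-cut theorem: the mass of $y$ has to be divided, as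
  $\theta y$ and $(1 - \theta) y$ with $0 \le \theta \le 1$, so that
  $E_1(\theta y) \le 1$ and $E_2((1 - \theta) y) \le 1$ (\<open>balanced_splitting\<close>). Then
  $x_1 = \theta x$ and $x_2 = (1 - \theta) x$ have norm at most one, whence the constant two.
  To find $\theta$, minimise a penalty $J(\theta)$ for exceeding the bounds: the integral of
  $h(E_1(\theta y)) + h(E_2((1 - \theta) y))$ for a convex function $h$ whose derivative is
  positive exactly to the right of $1$. Let $f_1$, $f_2$ be the values of $h'$ at the two
  conditional expectations. Moving $\theta$ towards the indicator function of
  $\{f_1 < f_2\}$ cannot decrease $J$, and this says
  \[ \int f_1 E_1(\theta y) + f_2 E_2((1 - \theta) y) \, d\mu
      = \int y (\theta f_1 + (1 - \theta) f_2) \, d\mu \le \int y \min(f_1, f_2) \, d\mu. \]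
  Integrating the hypothesis over the level sets $\{f_1 > t\}$ and $\{f_2 > t\}$ bounds the
  right-hand side by $\int f_1 + f_2$ (\<open>intersection_condition_layer_cake\<close>). So
  $f_1 (E_1(\theta y) - 1) + f_2 (E_2((1 - \theta) y) - 1)$ has integral at most zero; as both
  terms are nonnegative, they vanish, and neither bound is exceeded.

  A minimiser exists (\<open>fractions_minimizer\<close>) because the sublevel sets of $J$ are
  midpoint-convex: elements of nearly least $L_2$ norm in shrinking sublevel sets form a Cauchy
  sequence by the parallelogram law, and $J$ is continuous along it.
\<close>

section \<open>Minimisation over measurable functions with values in the unit interval\<close>

definition fractions :: "'a measure \<Rightarrow> ('a \<Rightarrow> real) set" where
  "fractions M = {\<theta> \<in> borel_measurable M. \<forall>\<omega>. 0 \<le> \<theta> \<omega> \<and> \<theta> \<omega> \<le> 1}"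

lemma fractions_bounds:
  assumes "\<theta> \<in> fractions M"
  shows "0 \<le> \<theta> \<omega>" "\<theta> \<omega> \<le> 1"
  using assms by (auto simp: fractions_def)

lemma fractions_midpoint:
  assumes "s \<in> fractions M" "t \<in> fractions M"
  shows "(\<lambda>\<omega>. (s \<omega> + t \<omega>) / 2) \<in> fractions M"
proof -
  have [measurable]: "s \<in> borel_measurable M" "t \<in> borel_measurable M"
    using assms by (auto simp: fractions_def)
  have "0 \<le> (s \<omega> + t \<omega>) / 2 \<and> (s \<omega> + t \<omega>) / 2 \<le> 1" for \<omega>
    using fractions_bounds[OF assms(1), of \<omega>] fractions_bounds[OF assms(2), of \<omega>] by auto
  then show ?thesis by (simp add: fractions_def)
qed

lemma (in prob_space) fractions_mult_integrable:
  assumes "s \<in> fractions M" "t \<in> fractions M" 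
  shows "integrable M (\<lambda>\<omega>. s \<omega> * t \<omega>)"
proof (rule integrable_const_bound[where B=1])
  have [measurable]: "s \<in> borel_measurable M" "t \<in> borel_measurable M"
    using assms by (auto simp: fractions_def)
  show "(\<lambda>\<omega>. s \<omega> * t \<omega>) \<in> borel_measurable M" by measurable
  show "AE \<omega> in M. norm (s \<omega> * t \<omega>) \<le> 1"
    using fractions_bounds[OF assms(1)] fractions_bounds[OF assms(2)]
    by (auto simp: abs_mult intro!: mult_le_one)
qed

text \<open>
  The $L_2$ norm dominates the $L_1$ norm on a probability space, and an $L_1$ Cauchy sequence has
  a subsequence that is almost everywhere Cauchy.
\<close>

lemma (in prob_space) fractions_Cauchy_limit:
  fixes s :: "nat \<Rightarrow> 'a \<Rightarrow> real"
  assumes s: "\<And>n. s n \<in> fractions M"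
    and Cauchy: "\<And>e. e > 0 \<Longrightarrow> \<exists>N. \<forall>i\<ge>N. \<forall>j\<ge>N. (\<integral>\<omega>. (s i \<omega> - s j \<omega>)\<^sup>2 \<partial>M) < e"
  obtains r t where "strict_mono r" "t \<in> fractions M" "AE \<omega> in M. (\<lambda>n. s (r n) \<omega>) \<longlonglongrightarrow> t \<omega>"
proof -
  have [measurable]: "s n \<in> borel_measurable M" for n
    using s by (auto simp: fractions_def)
  have int1: "integrable M (s n)" for n
    using fractions_bounds[OF s] by (intro integrable_const_bound[where B=1]) auto
  have int2: "integrable M (\<lambda>\<omega>. (s i \<omega> - s j \<omega>)\<^sup>2)" for i j
  proof -
    have "(\<lambda>\<omega>. (s i \<omega> - s j \<omega>)\<^sup>2)
        = (\<lambda>\<omega>. s i \<omega> * s i \<omega> + s j \<omega> * s j \<omega> - 2 * (s i \<omega> * s j \<omega>))"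
      by (auto simp: power2_eq_square algebra_simps)
    then show ?thesis
      by (simp add: fractions_mult_integrable[OF s s])
  qed
  have L1: "\<exists>N. \<forall>i\<ge>N. \<forall>j\<ge>N. (\<integral>\<omega>. norm (s i \<omega> - s j \<omega>) \<partial>M) < e" if "e > 0" for e
  proof -
    obtain N where N: "\<And>i j. i \<ge> N \<Longrightarrow> j \<ge> N \<Longrightarrow> (\<integral>\<omega>. (s i \<omega> - s j \<omega>)\<^sup>2 \<partial>M) < e\<^sup>2"
      using Cauchy[of "e\<^sup>2"] \<open>e > 0\<close> by auto
    have "(\<integral>\<omega>. norm (s i \<omega> - s j \<omega>) \<partial>M) < e" if "i \<ge> N" "j \<ge> N" for i j
    proof -
      have ptw: "\<bar>d\<bar> \<le> e / 2 + d\<^sup>2 / (2 * e)" for d :: real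
      proof -
        have "0 \<le> (\<bar>d\<bar> - e)\<^sup>2" by simp
        then have "2 * e * \<bar>d\<bar> \<le> e\<^sup>2 + d\<^sup>2" by (simp add: power2_diff algebra_simps)
        then show ?thesis using \<open>e > 0\<close> by (simp add: field_simps power2_eq_square)
      qed
      have "(\<integral>\<omega>. norm (s i \<omega> - s j \<omega>) \<partial>M) \<le> (\<integral>\<omega>. e / 2 + (s i \<omega> - s j \<omega>)\<^sup>2 / (2 * e) \<partial>M)"
        using ptw int1 int2 by (intro integral_mono) auto
      also have "\<dots> = e / 2 + (\<integral>\<omega>. (s i \<omega> - s j \<omega>)\<^sup>2 \<partial>M) / (2 * e)"
        using int2 by (simp add: prob_space)
      also have "\<dots> < e / 2 + e\<^sup>2 / (2 * e)"
        using N[OF that] \<open>e > 0\<close> by (intro add_strict_left_mono divide_strict_right_mono) auto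
      also have "\<dots> = e" using \<open>e > 0\<close> by (simp add: power2_eq_square)
      finally show ?thesis .
    qed
    then show ?thesis by blast
  qed
  obtain r where r: "strict_mono r" and cau: "AE \<omega> in M. Cauchy (\<lambda>i. s (r i) \<omega>)"
    using cauchy_L1_AE_cauchy_subseq[OF int1 L1] by blast
  \<comment> \<open>The truncation keeps the values in the unit interval where the sequence diverges.\<close>
  define t where "t = (\<lambda>\<omega>. max 0 (min 1 (lim (\<lambda>i. s (r i) \<omega>))))"
  have "t \<in> fractions M"
    unfolding fractions_def t_def by auto
  moreover have "AE \<omega> in M. (\<lambda>n. s (r n) \<omega>) \<longlonglongrightarrow> t \<omega>"
    using cau
  proof eventually_elim
    case (elim \<omega>)
    then have l: "(\<lambda>n. s (r n) \<omega>) \<longlonglongrightarrow> lim (\<lambda>n. s (r n) \<omega>)"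
      by (simp add: Cauchy_convergent convergent_LIMSEQ_iff[symmetric])
    have "0 \<le> lim (\<lambda>n. s (r n) \<omega>)" "lim (\<lambda>n. s (r n) \<omega>) \<le> 1"
      using fractions_bounds[OF s] by (auto intro: LIMSEQ_le_const[OF l] LIMSEQ_le_const2[OF l])
    then show ?case using l by (simp add: t_def)
  qed
  ultimately show ?thesis using that r by blast
qed

text \<open>
  This replaces weak compactness of the unit interval in $L_\infty$. A minimising sequence need not
  converge, so a particular one is chosen: its $n$-th term has almost least $L_2$ norm in the
  sublevel set \<open>K n\<close>. Midpoints of later terms stay in \<open>K n\<close>, so their norm cannot be much
  smaller, and the parallelogram law makes the terms close to each other.
\<close>

lemma (in prob_space) fractions_minimizer:
  fixes J :: "('a \<Rightarrow> real) \<Rightarrow> real"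
  assumes bdd: "\<And>s. s \<in> fractions M \<Longrightarrow> 0 \<le> J s"
    and mid: "\<And>s t. s \<in> fractions M \<Longrightarrow> t \<in> fractions M \<Longrightarrow>
        J (\<lambda>\<omega>. (s \<omega> + t \<omega>) / 2) \<le> max (J s) (J t)"
    and cont: "\<And>s t. (\<And>n. s n \<in> fractions M) \<Longrightarrow> t \<in> fractions M \<Longrightarrow>
        AE \<omega> in M. (\<lambda>n::nat. s n \<omega>) \<longlonglongrightarrow> t \<omega> \<Longrightarrow> (\<lambda>n. J (s n)) \<longlonglongrightarrow> J t"
  obtains t where "t \<in> fractions M" "\<And>s. s \<in> fractions M \<Longrightarrow> J t \<le> J s"
proof -
  define m where "m = Inf (J ` fractions M)"
  define K where "K n = {s \<in> fractions M. J s \<le> m + 1 / Suc n}" for n :: nat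
  define Q where "Q s = (\<integral>\<omega>. (s \<omega>)\<^sup>2 \<partial>M)" for s :: "'a \<Rightarrow> real"
  define r where "r n = Inf (Q ` K n)" for n
  have ne: "fractions M \<noteq> {}"
    unfolding fractions_def by (auto intro!: exI[of _ "\<lambda>_. 0"])
  have m_le: "m \<le> J s" if "s \<in> fractions M" for s
    unfolding m_def using bdd that by (auto intro!: cInf_lower bdd_belowI[where m=0])
  have K_ne: "K n \<noteq> {}" for n
  proof -
    have "\<exists>v \<in> J ` fractions M. v < m + 1 / Suc n"
      using cInf_lessD[of "J ` fractions M" "m + 1 / Suc n"] ne by (auto simp: m_def)
    then show ?thesis by (force simp: K_def)
  qed
  have K_sub: "K n \<subseteq> fractions M" for n by (auto simp: K_def)
  have K_anti: "K j \<subseteq> K i" if "i \<le> j" for i j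
  proof -
    have "1 / real (Suc j) \<le> 1 / real (Suc i)" using that by (intro divide_left_mono) auto
    then show ?thesis unfolding K_def by auto
  qed
  have Q0: "0 \<le> Q s" for s by (simp add: Q_def)
  have r_le: "r n \<le> Q s" if "s \<in> K n" for n s
    unfolding r_def using that Q0 by (auto intro!: cInf_lower bdd_belowI[where m=0])
  have r_mono: "r i \<le> r j" if "i \<le> j" for i j
    unfolding r_def using K_ne K_anti[OF that] Q0
    by (intro cInf_superset_mono) (auto intro!: bdd_belowI[where m=0])
  have Q1: "Q s \<le> 1" if "s \<in> fractions M" for s
  proof -
    have "Q s \<le> (\<integral>\<omega>. 1 \<partial>M)"
      unfolding Q_def using fractions_bounds[OF that] fractions_mult_integrable[OF that that]
      by (intro integral_mono) (auto simp: power2_eq_square intro!: mult_le_one)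
    then show ?thesis by (simp add: prob_space)
  qed
  have "norm (r n) \<le> 1" for n
  proof -
    obtain s where "s \<in> K n" using K_ne by blast
    then have "r n \<le> 1" using r_le[of s n] Q1[of s] K_sub[of n] by auto
    moreover have "0 \<le> r n" unfolding r_def using K_ne Q0 by (intro cInf_greatest) auto
    ultimately show ?thesis by simp
  qed
  then have "convergent r"
    using r_mono by (intro Bseq_mono_convergent BseqI'[where K=1]) auto
  then have r_Cauchy: "Cauchy r" by (rule convergent_Cauchy)
  have "\<exists>s. s \<in> K n \<and> Q s < r n + 1 / Suc n" for n
    using cInf_lessD[of "Q ` K n" "r n + 1 / Suc n"] K_ne by (auto simp: r_def)
  then obtain s where s: "\<And>n. s n \<in> K n" and Qs: "\<And>n. Q (s n) < r n + 1 / Suc n"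
    by metis
  have sf: "s n \<in> fractions M" for n using s K_sub by blast
  \<comment> \<open>The parallelogram law, with the midpoint tested against the infimum over \<open>K i\<close>.\<close>
  have key: "(\<integral>\<omega>. (s i \<omega> - s j \<omega>)\<^sup>2 \<partial>M) \<le> 2 * (r j - r i) + 4 / Suc i" if "i \<le> j" for i j
  proof -
    have mK: "(\<lambda>\<omega>. (s i \<omega> + s j \<omega>) / 2) \<in> K i"
    proof -
      have "s j \<in> K i" using K_anti[OF that] s by blast
      then show ?thesis
        using mid[OF sf[of i] sf[of j]] s[of i] fractions_midpoint[OF sf sf] by (auto simp: K_def)
    qed
    have i1: "integrable M (\<lambda>\<omega>. (s k \<omega>)\<^sup>2)" for k
      using fractions_mult_integrable[OF sf sf] by (simp add: power2_eq_square)
    have i2: "integrable M (\<lambda>\<omega>. ((s i \<omega> + s j \<omega>) / 2)\<^sup>2)"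
      using fractions_mult_integrable[OF fractions_midpoint[OF sf sf] fractions_midpoint[OF sf sf]] 
      unfolding power2_eq_square by blast
    have "(\<integral>\<omega>. (s i \<omega> - s j \<omega>)\<^sup>2 \<partial>M)
        = (\<integral>\<omega>. 2 * (s i \<omega>)\<^sup>2 + 2 * (s j \<omega>)\<^sup>2 - 4 * ((s i \<omega> + s j \<omega>) / 2)\<^sup>2 \<partial>M)"
      by (intro Bochner_Integration.integral_cong) (auto simp: power2_eq_square field_simps)
    also have "\<dots> = 2 * Q (s i) + 2 * Q (s j) - 4 * Q (\<lambda>\<omega>. (s i \<omega> + s j \<omega>) / 2)"
      unfolding Q_def using i1 i2 by (subst Bochner_Integration.integral_diff) auto
    also have "\<dots> \<le> 2 * (r i + 1 / Suc i) + 2 * (r j + 1 / Suc i) - 4 * r i"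
    proof -
      have "1 / real (Suc j) \<le> 1 / real (Suc i)" using that by (intro divide_left_mono) auto
      then have "Q (s j) \<le> r j + 1 / Suc i" using Qs[of j] by linarith
      moreover have "Q (s i) \<le> r i + 1 / Suc i" using Qs[of i] by linarith
      ultimately show ?thesis
        using r_le[OF mK] by (intro diff_mono add_mono mult_left_mono) auto
    qed
    finally show ?thesis by (simp add: algebra_simps)
  qed
  have Cau: "\<exists>N. \<forall>i\<ge>N. \<forall>j\<ge>N. (\<integral>\<omega>. (s i \<omega> - s j \<omega>)\<^sup>2 \<partial>M) < e" if "e > 0" for e
  proof -
    obtain N1 where N1: "\<And>i j. i \<ge> N1 \<Longrightarrow> j \<ge> N1 \<Longrightarrow> \<bar>r j - r i\<bar> < e / 4"
      using CauchyD[OF r_Cauchy, of "e / 4"] \<open>e > 0\<close> by (auto simp: dist_real_def)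
    obtain N2 :: nat where N2: "8 / e < N2" using reals_Archimedean2 by blast
    have *: "(\<integral>\<omega>. (s i \<omega> - s j \<omega>)\<^sup>2 \<partial>M) < e" if "i \<ge> max N1 N2" "i \<le> j" for i j
    proof -
      have "8 / e < Suc i" using N2 that by simp
      then have "4 / Suc i < e / 2" using \<open>e > 0\<close> by (simp add: field_simps)
      moreover have "\<bar>r j - r i\<bar> < e / 4" using N1[of i j] that by simp
      then have "2 * (r j - r i) < e / 2" by argo
      ultimately show ?thesis using key[OF \<open>i \<le> j\<close>] by linarith
    qed
    have "(\<integral>\<omega>. (s i \<omega> - s j \<omega>)\<^sup>2 \<partial>M) < e" if "i \<ge> max N1 N2" "j \<ge> max N1 N2" for i j
      using *[of i j] *[of j i] that by (cases "i \<le> j") (auto simp: power2_commute)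
    then show ?thesis by blast
  qed
  obtain \<rho> t where \<rho>: "strict_mono \<rho>" and t: "t \<in> fractions M"
    and lim: "AE \<omega> in M. (\<lambda>n. s (\<rho> n) \<omega>) \<longlonglongrightarrow> t \<omega>"
    using fractions_Cauchy_limit[OF sf Cau] by blast
  have J_lim: "(\<lambda>n. J (s (\<rho> n))) \<longlonglongrightarrow> J t"
    using cont[OF sf t lim] .
  have "J (s (\<rho> n)) \<le> m + 1 / Suc n" for n
    using s[of "\<rho> n"] K_anti[OF seq_suble[OF \<rho>]] by (auto simp: K_def)
  moreover have "(\<lambda>n. m + 1 / real (Suc n)) \<longlonglongrightarrow> m"
    using LIMSEQ_inverse_real_of_nat_add[of m] by (simp add: inverse_eq_divide)
  ultimately have "J t \<le> m" using LIMSEQ_le[OF J_lim] by blast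
  then show ?thesis using that[OF t] m_le by force
qed

section \<open>The Huber penalty of a conditional expectation\<close>

text \<open>
  The derivative of the penalty. A quadratic penalty would be simpler, but the conditional
  expectations are only in $L_1$, so the derivative has to be bounded.
\<close>

definition huber_slope :: "real \<Rightarrow> real" where
  "huber_slope s = max 0 (min 1 (s - 1))"

text \<open>
  The Huber function, zero up to $1$, quadratic on $[1, 2]$ and affine beyond. It is the maximum of
  $c (s - 1) - c^2 / 2$ over $c \in [0, 1]$, attained at the slope; written this way it visibly lies
  above all its tangents.
\<close>

definition huber :: "real \<Rightarrow> real" where
  "huber s = huber_slope s * (s - 1) - (huber_slope s)\<^sup>2 / 2"

lemma huber_slope_bounds: "0 \<le> huber_slope s" "huber_slope s \<le> 1"
  by (auto simp: huber_slope_def)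

lemma huber_slope_measurable [measurable]: "huber_slope \<in> borel_measurable borel"
  unfolding huber_slope_def by measurable

lemma huber_measurable [measurable]: "huber \<in> borel_measurable borel"
  unfolding huber_def by measurable

lemma huber_slope_isCont: "isCont huber_slope s"
  unfolding huber_slope_def by (intro continuous_intros)

text \<open>
  Evaluate at $a$ the affine function of $s$ with parameter $c = $ \<open>huber_slope b\<close>: it is below
  the maximum \<open>huber a\<close>. Convexity of the penalty enters only through this
  inequality.
\<close>

lemma huber_tangent: "huber b - huber a \<le> huber_slope b * (b - a)"
proof -
  have "c * (a - 1) - c\<^sup>2 / 2 \<le> huber a" if "0 \<le> c" "c \<le> 1" for c
  proof (cases "a \<le> 1")
    case True
    then have "c * (a - 1) \<le> 0" using that by (simp add: mult_nonneg_nonpos)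
    moreover have "huber a = 0" using True by (simp add: huber_def huber_slope_def)
    ultimately show ?thesis by (smt (verit) zero_le_power2 divide_nonneg_pos)
  next
    case False
    show ?thesis
    proof (cases "a \<le> 2")
      case True
      then have "huber a = (a - 1)\<^sup>2 / 2"
        using False by (simp add: huber_def huber_slope_def power2_eq_square)
      moreover have "0 \<le> (a - 1 - c)\<^sup>2" by simp
      ultimately show ?thesis by (simp add: power2_eq_square algebra_simps)
    next
      case False
      have "huber a = (a - 1) - 1 / 2"
        using False by (simp add: huber_def huber_slope_def)
      moreover have "0 \<le> (1 - c) * (a - 1 - (1 + c) / 2)"
        using False that by (intro mult_nonneg_nonneg) auto
      moreover have "(1 - c) * (a - 1 - (1 + c) / 2) = (a - 1) - 1 / 2 - (c * (a - 1) - c\<^sup>2 / 2)"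
        by (simp add: power2_eq_square field_simps)
      ultimately show ?thesis by linarith
    qed
  qed
  from this[of "huber_slope b"] show ?thesis
    using huber_slope_bounds[of b] by (simp add: huber_def algebra_simps)
qed

lemma huber_bounds: "0 \<le> huber s" "huber s \<le> \<bar>s\<bar>"
proof -
  show "0 \<le> huber s" using huber_tangent[of 0 s] by (simp add: huber_def huber_slope_def)
  have "huber s \<le> huber_slope s * s" using huber_tangent[of s 0] by (simp add: huber_def huber_slope_def)
  also have "\<dots> \<le> huber_slope s * \<bar>s\<bar>"
    using huber_slope_bounds[of s] by (intro mult_left_mono) auto
  also have "\<dots> \<le> \<bar>s\<bar>"
    using huber_slope_bounds[of s] by (intro mult_left_le_one_le) auto
  finally show "huber s \<le> \<bar>s\<bar>" .
qed

definition overload :: "'a measure \<Rightarrow> 'a measure \<Rightarrow> ('a \<Rightarrow> real) \<Rightarrow> real" where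
  "overload M B z = (\<integral>\<omega>. huber (real_cond_exp M B z \<omega>) \<partial>M)"

abbreviation pressure :: "'a measure \<Rightarrow> 'a measure \<Rightarrow> ('a \<Rightarrow> real) \<Rightarrow> 'a \<Rightarrow> real" where
  "pressure M B z \<omega> \<equiv> huber_slope (real_cond_exp M B z \<omega>)"

context finite_measure_subalgebra
begin

lemma huber_cond_exp_integrable:
  assumes "integrable M z"
  shows "integrable M (\<lambda>\<omega>. huber (real_cond_exp M F z \<omega>))"
  using huber_bounds 
  by (intro Bochner_Integration.integrable_bound[OF real_cond_exp_int(1)[OF assms]]) auto

text \<open>
  The pressure is measurable for the subalgebra, so integrated against it the conditional
  expectation of $w - z$ becomes $w - z$ itself. Hence the pressure is a subgradient of the
  functional \<open>overload\<close> on $L_1$; midpoint convexity and the Lipschitz bound follow from this.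
\<close>

lemma overload_tangent:
  assumes z: "integrable M z" and w: "integrable M w"
  shows "integrable M (\<lambda>\<omega>. pressure M F w \<omega> * (w \<omega> - z \<omega>))"
    and "overload M F w - overload M F z \<le> (\<integral>\<omega>. pressure M F w \<omega> * (w \<omega> - z \<omega>) \<partial>M)"
proof -
  have [measurable]: "z \<in> borel_measurable M" "w \<in> borel_measurable M" using z w by auto
  show int: "integrable M (\<lambda>\<omega>. pressure M F w \<omega> * (w \<omega> - z \<omega>))"
    using huber_slope_bounds
    by (intro Bochner_Integration.integrable_bound[OF Bochner_Integration.integrable_diff[OF w z]])
      (auto simp: abs_mult intro!: mult_left_le_one_le)
  have diff: "AE \<omega> in M. real_cond_exp M F (\<lambda>\<omega>. w \<omega> - z \<omega>) \<omega> = real_cond_exp M F w \<omega> - real_cond_exp M F z \<omega>"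
    using w z by (rule real_cond_exp_diff)
  note g = real_cond_exp_intg[OF int]
  have "overload M F w - overload M F z
      = (\<integral>\<omega>. huber (real_cond_exp M F w \<omega>) - huber (real_cond_exp M F z \<omega>) \<partial>M)"
    unfolding overload_def using z w by (simp add: huber_cond_exp_integrable)
  also have "\<dots> \<le> (\<integral>\<omega>. pressure M F w \<omega> * real_cond_exp M F (\<lambda>\<omega>. w \<omega> - z \<omega>) \<omega> \<partial>M)"
  proof (rule integral_mono_AE)
    show "AE \<omega> in M. huber (real_cond_exp M F w \<omega>) - huber (real_cond_exp M F z \<omega>)
        \<le> pressure M F w \<omega> * real_cond_exp M F (\<lambda>\<omega>. w \<omega> - z \<omega>) \<omega>"
      using diff by eventually_elim (simp add: huber_tangent)
  qed (use z w g(1) in \<open>auto simp: huber_cond_exp_integrable\<close>)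
  also have "\<dots> = (\<integral>\<omega>. pressure M F w \<omega> * (w \<omega> - z \<omega>) \<partial>M)"
    by (rule g(2)) auto
  finally show "overload M F w - overload M F z \<le> (\<integral>\<omega>. pressure M F w \<omega> * (w \<omega> - z \<omega>) \<partial>M)" .
qed

lemma overload_nonneg: "0 \<le> overload M F z"
  unfolding overload_def by (simp add: huber_bounds)

lemma overload_midpoint:
  assumes z: "integrable M z" and w: "integrable M w"
  shows "overload M F (\<lambda>\<omega>. (z \<omega> + w \<omega>) / 2) \<le> (overload M F z + overload M F w) / 2"
proof -
  let ?v = "\<lambda>\<omega>. (z \<omega> + w \<omega>) / 2"
  have v: "integrable M ?v" using z w by auto
  have "(\<integral>\<omega>. pressure M F ?v \<omega> * (?v \<omega> - z \<omega>) \<partial>M) + (\<integral>\<omega>. pressure M F ?v \<omega> * (?v \<omega> - w \<omega>) \<partial>M)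
      = (\<integral>\<omega>. pressure M F ?v \<omega> * (?v \<omega> - z \<omega>) + pressure M F ?v \<omega> * (?v \<omega> - w \<omega>) \<partial>M)"
    using overload_tangent(1)[OF z v] overload_tangent(1)[OF w v] by simp
  also have "\<dots> = (\<integral>\<omega>. 0 \<partial>M)"
    by (intro Bochner_Integration.integral_cong) (auto simp: field_simps)
  finally show ?thesis
    using overload_tangent(2)[OF z v] overload_tangent(2)[OF w v] by simp
qed

lemma overload_lipschitz:
  assumes z: "integrable M z" and w: "integrable M w"
  shows "overload M F w - overload M F z \<le> (\<integral>\<omega>. \<bar>w \<omega> - z \<omega>\<bar> \<partial>M)"
proof -
  have "(\<integral>\<omega>. pressure M F w \<omega> * (w \<omega> - z \<omega>) \<partial>M) \<le> (\<integral>\<omega>. \<bar>w \<omega> - z \<omega>\<bar> \<partial>M)"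
  proof (rule integral_mono)
    fix \<omega>
    have "pressure M F w \<omega> * (w \<omega> - z \<omega>) \<le> pressure M F w \<omega> * \<bar>w \<omega> - z \<omega>\<bar>"
      using huber_slope_bounds by (intro mult_left_mono) auto
    also have "\<dots> \<le> \<bar>w \<omega> - z \<omega>\<bar>"
      using huber_slope_bounds by (intro mult_left_le_one_le) auto
    finally show "pressure M F w \<omega> * (w \<omega> - z \<omega>) \<le> \<bar>w \<omega> - z \<omega>\<bar>" .
  qed (use overload_tangent(1)[OF z w] z w in auto)
  then show ?thesis using overload_tangent(2)[OF z w] by linarith
qed

lemma overload_tendsto:
  assumes z: "\<And>n. integrable M (z n)" and w: "integrable M w" and y: "integrable M y"
    and lim: "AE \<omega> in M. (\<lambda>n. z n \<omega>) \<longlonglongrightarrow> w \<omega>"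
    and bound: "\<And>n \<omega>. \<bar>z n \<omega>\<bar> \<le> y \<omega>"
  shows "(\<lambda>n. overload M F (z n)) \<longlonglongrightarrow> overload M F w"
proof -
  have [measurable]: "z n \<in> borel_measurable M" "w \<in> borel_measurable M" for n using z w by auto
  have "(\<lambda>n. \<integral>\<omega>. \<bar>z n \<omega> - w \<omega>\<bar> \<partial>M) \<longlonglongrightarrow> (\<integral>\<omega>. 0 \<partial>M)"
  proof (rule integral_dominated_convergence[where w="\<lambda>\<omega>. y \<omega> + \<bar>w \<omega>\<bar>"])
    show "AE \<omega> in M. (\<lambda>n. \<bar>z n \<omega> - w \<omega>\<bar>) \<longlonglongrightarrow> 0"
      using lim by eventually_elim (simp add: LIM_zero tendsto_rabs_zero)
    show "AE \<omega> in M. norm \<bar>z n \<omega> - w \<omega>\<bar> \<le> y \<omega> + \<bar>w \<omega>\<bar>" for n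
    proof (rule AE_I2)
      fix \<omega> show "norm \<bar>z n \<omega> - w \<omega>\<bar> \<le> y \<omega> + \<bar>w \<omega>\<bar>" using bound[of n \<omega>] by auto
    qed
  qed (use w y in auto)
  then have l: "(\<lambda>n. \<integral>\<omega>. \<bar>z n \<omega> - w \<omega>\<bar> \<partial>M) \<longlonglongrightarrow> 0" by simp
  have "\<bar>overload M F (z n) - overload M F w\<bar> \<le> (\<integral>\<omega>. \<bar>z n \<omega> - w \<omega>\<bar> \<partial>M)" for n
    using overload_lipschitz[OF w z[of n]] overload_lipschitz[OF z[of n] w]
    by (simp add: abs_le_iff abs_minus_commute)
  then have "(\<lambda>n. overload M F (z n) - overload M F w) \<longlonglongrightarrow> 0"
    by (intro Lim_null_comparison[OF _ l]) auto
  then show ?thesis by (simp add: LIM_zero_iff)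
qed

end

section \<open>From sets to functions in the intersection condition\<close>

lemma measurable_subalgebra_level:
  fixes f :: "'a \<Rightarrow> real"
  assumes "subalgebra M B" "f \<in> borel_measurable B"
  shows "{\<omega> \<in> space M. t < f \<omega>} \<in> sets B"
proof -
  have "{\<omega> \<in> space B. t < f \<omega>} \<in> sets B"
    using assms(2) by (simp add: borel_measurable_iff_greater)
  then show ?thesis using assms(1) by (simp add: subalgebra_def)
qed

text \<open>
  The level sets of $\min(f_1, f_2)$ are the intersections of those of $f_1$ and $f_2$, which lie in
  the respective subalgebras. Apply the condition to each of them and integrate over the level.
\<close>

lemma (in prob_space) intersection_condition_layer_cake:
  fixes y f1 f2 :: "'a \<Rightarrow> real"
  assumes sub: "subalgebra M B1" "subalgebra M B2"
    and y[measurable]: "y \<in> borel_measurable M" and y0: "\<And>\<omega>. 0 \<le> y \<omega>"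
    and cond: "intersection_condition M B1 B2 y"
    and f: "f1 \<in> borel_measurable B1" "f2 \<in> borel_measurable B2"
    and f0: "\<And>\<omega>. 0 \<le> f1 \<omega>" "\<And>\<omega>. 0 \<le> f2 \<omega>"
  shows "(\<integral>\<^sup>+\<omega>. ennreal (y \<omega> * min (f1 \<omega>) (f2 \<omega>)) \<partial>M)
      \<le> (\<integral>\<^sup>+\<omega>. ennreal (f1 \<omega>) \<partial>M) + (\<integral>\<^sup>+\<omega>. ennreal (f2 \<omega>) \<partial>M)"
proof -
  interpret pair_sigma_finite M lborel by unfold_locales
  have [measurable]: "f1 \<in> borel_measurable M" "f2 \<in> borel_measurable M"
    using measurable_from_subalg[OF sub(1) f(1)] measurable_from_subalg[OF sub(2) f(2)] by auto
  have cake: "ennreal a = (\<integral>\<^sup>+t. (if 0 \<le> t \<and> t < a then 1 else 0) \<partial>lborel)" if "0 \<le> a" for a :: real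
  proof -
    have "(\<integral>\<^sup>+t. (if 0 \<le> t \<and> t < a then 1 else 0) \<partial>lborel) = (\<integral>\<^sup>+t. indicator {0..<a} t \<partial>lborel)"
      by (intro nn_integral_cong) (auto simp: indicator_def)
    then show ?thesis using that by simp
  qed
  have swap: "(\<integral>\<^sup>+\<omega>. w \<omega> * ennreal (h \<omega>) \<partial>M)
      = (\<integral>\<^sup>+t. (\<integral>\<^sup>+\<omega>. w \<omega> * (if 0 \<le> t \<and> t < h \<omega> then 1 else 0) \<partial>M) \<partial>lborel)"
    if [measurable]: "w \<in> borel_measurable M" "h \<in> borel_measurable M" and h0: "\<And>\<omega>. 0 \<le> h \<omega>"
    for w :: "'a \<Rightarrow> ennreal" and h :: "'a \<Rightarrow> real"
  proof -
    have "(\<integral>\<^sup>+\<omega>. w \<omega> * ennreal (h \<omega>) \<partial>M)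
        = (\<integral>\<^sup>+\<omega>. (\<integral>\<^sup>+t. w \<omega> * (if 0 \<le> t \<and> t < h \<omega> then 1 else 0) \<partial>lborel) \<partial>M)"
      by (subst cake[OF h0]) (simp add: nn_integral_cmult)
    also have "\<dots> = (\<integral>\<^sup>+t. (\<integral>\<^sup>+\<omega>. w \<omega> * (if 0 \<le> t \<and> t < h \<omega> then 1 else 0) \<partial>M) \<partial>lborel)"
      by (rule Fubini'[symmetric]) measurable
    finally show ?thesis .
  qed
  have level: "(\<integral>\<^sup>+\<omega>. ennreal (y \<omega>) * (if 0 \<le> t \<and> t < min (f1 \<omega>) (f2 \<omega>) then 1 else 0) \<partial>M)
      \<le> (\<integral>\<^sup>+\<omega>. 1 * (if 0 \<le> t \<and> t < f1 \<omega> then 1 else 0) \<partial>M)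
        + (\<integral>\<^sup>+\<omega>. 1 * (if 0 \<le> t \<and> t < f2 \<omega> then 1 else 0) \<partial>M)" for t
  proof (cases "0 \<le> t")
    case True
    let ?E1 = "{\<omega> \<in> space M. t < f1 \<omega>}" and ?E2 = "{\<omega> \<in> space M. t < f2 \<omega>}"
    have E: "?E1 \<in> sets B1" "?E2 \<in> sets B2"
      using measurable_subalgebra_level[OF sub(1) f(1)] measurable_subalgebra_level[OF sub(2) f(2)] by auto
    have "(\<integral>\<^sup>+\<omega>. ennreal (y \<omega>) * (if 0 \<le> t \<and> t < min (f1 \<omega>) (f2 \<omega>) then 1 else 0) \<partial>M)
        = (\<integral>\<^sup>+\<omega>\<in>?E1 \<inter> ?E2. ennreal (norm (y \<omega>)) \<partial>M)"
      using True y0 by (intro nn_integral_cong) (auto simp: indicator_def)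
    also have "\<dots> \<le> emeasure M ?E1 + emeasure M ?E2"
      using cond E unfolding intersection_condition_def by blast
    also have "\<dots> = (\<integral>\<^sup>+\<omega>. indicator ?E1 \<omega> \<partial>M) + (\<integral>\<^sup>+\<omega>. indicator ?E2 \<omega> \<partial>M)"
      by simp
    also have "\<dots> = (\<integral>\<^sup>+\<omega>. 1 * (if 0 \<le> t \<and> t < f1 \<omega> then 1 else 0) \<partial>M)
        + (\<integral>\<^sup>+\<omega>. 1 * (if 0 \<le> t \<and> t < f2 \<omega> then 1 else 0) \<partial>M)"
      using True by (intro arg_cong2[where f="(+)"] nn_integral_cong) (auto simp: indicator_def)
    finally show ?thesis .
  qed simp
  have "(\<integral>\<^sup>+\<omega>. ennreal (y \<omega> * min (f1 \<omega>) (f2 \<omega>)) \<partial>M)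
      = (\<integral>\<^sup>+\<omega>. ennreal (y \<omega>) * ennreal (min (f1 \<omega>) (f2 \<omega>)) \<partial>M)"
    using y0 f0 by (simp add: ennreal_mult)
  also have "\<dots> = (\<integral>\<^sup>+t. (\<integral>\<^sup>+\<omega>. ennreal (y \<omega>) * (if 0 \<le> t \<and> t < min (f1 \<omega>) (f2 \<omega>) then 1 else 0) \<partial>M) \<partial>lborel)"
    using f0 by (intro swap) auto
  also have "\<dots> \<le> (\<integral>\<^sup>+t. (\<integral>\<^sup>+\<omega>. 1 * (if 0 \<le> t \<and> t < f1 \<omega> then 1 else 0) \<partial>M)
        + (\<integral>\<^sup>+\<omega>. 1 * (if 0 \<le> t \<and> t < f2 \<omega> then 1 else 0) \<partial>M) \<partial>lborel)"
    by (intro nn_integral_mono level)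
  also have "\<dots> = (\<integral>\<^sup>+t. (\<integral>\<^sup>+\<omega>. 1 * (if 0 \<le> t \<and> t < f1 \<omega> then 1 else 0) \<partial>M) \<partial>lborel)
        + (\<integral>\<^sup>+t. (\<integral>\<^sup>+\<omega>. 1 * (if 0 \<le> t \<and> t < f2 \<omega> then 1 else 0) \<partial>M) \<partial>lborel)"
    by (rule nn_integral_add) measurable
  also have "\<dots> = (\<integral>\<^sup>+\<omega>. 1 * ennreal (f1 \<omega>) \<partial>M) + (\<integral>\<^sup>+\<omega>. 1 * ennreal (f2 \<omega>) \<partial>M)"
    using f0 by (intro arg_cong2[where f="(+)"] swap[symmetric]) auto
  finally show ?thesis by simp
qed

section \<open>Splitting a function between the two subalgebras\<close>

text \<open>
  At a minimiser \<open>\<theta>\<close> of the total overload, mass flows only towards the side of smaller pressure.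
  The condition, in its layer cake form, then leaves no room for positive pressure.
\<close>

lemma (in prob_space) balanced_splitting:
  fixes y :: "'a \<Rightarrow> real"
  assumes sub: "subalgebra M B1" "subalgebra M B2"
    and y: "integrable M y" and y0: "\<And>\<omega>. 0 \<le> y \<omega>"
    and cond: "intersection_condition M B1 B2 y"
  obtains \<theta> where "\<theta> \<in> fractions M"
    "AE \<omega> in M. real_cond_exp M B1 (\<lambda>\<omega>. \<theta> \<omega> * y \<omega>) \<omega> \<le> 1"
    "AE \<omega> in M. real_cond_exp M B2 (\<lambda>\<omega>. (1 - \<theta> \<omega>) * y \<omega>) \<omega> \<le> 1"
proof -
  interpret E1: finite_measure_subalgebra M B1 using sub(1) by unfold_locales
  interpret E2: finite_measure_subalgebra M B2 using sub(2) by unfold_locales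
  have [measurable]: "y \<in> borel_measurable M" using y by auto
  define z1 where "z1 \<theta> \<omega> = \<theta> \<omega> * y \<omega>" for \<theta> \<omega>
  define z2 where "z2 \<theta> \<omega> = (1 - \<theta> \<omega>) * y \<omega>" for \<theta> \<omega>
  define J where "J \<theta> = overload M B1 (z1 \<theta>) + overload M B2 (z2 \<theta>)" for \<theta>
  have z_bound: "\<bar>z1 s \<omega>\<bar> \<le> y \<omega>" "\<bar>z2 s \<omega>\<bar> \<le> y \<omega>" if "s \<in> fractions M" for s \<omega>
    using fractions_bounds[OF that, of \<omega>] y0[of \<omega>]
    by (auto simp: z1_def z2_def abs_mult intro!: mult_left_le_one_le)
  have z_int: "integrable M (z1 s)" "integrable M (z2 s)" if "s \<in> fractions M" for s
  proof -
    have [measurable]: "s \<in> borel_measurable M" using that by (simp add: fractions_def)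
    have [measurable]: "z1 s \<in> borel_measurable M" "z2 s \<in> borel_measurable M"
      unfolding z1_def z2_def by measurable
    show "integrable M (z1 s)" "integrable M (z2 s)"
      using z_bound[OF that] y0 by (auto intro!: Bochner_Integration.integrable_bound[OF y])
  qed
  have mid: "J (\<lambda>\<omega>. (s \<omega> + t \<omega>) / 2) \<le> max (J s) (J t)"
    if s: "s \<in> fractions M" and t: "t \<in> fractions M" for s t
  proof -
    have "z1 (\<lambda>\<omega>. (s \<omega> + t \<omega>) / 2) = (\<lambda>\<omega>. (z1 s \<omega> + z1 t \<omega>) / 2)"
      "z2 (\<lambda>\<omega>. (s \<omega> + t \<omega>) / 2) = (\<lambda>\<omega>. (z2 s \<omega> + z2 t \<omega>) / 2)"
      by (auto simp: z1_def z2_def field_simps)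
    then have "J (\<lambda>\<omega>. (s \<omega> + t \<omega>) / 2) \<le> (J s + J t) / 2"
      using E1.overload_midpoint[OF z_int(1)[OF s] z_int(1)[OF t]]
        E2.overload_midpoint[OF z_int(2)[OF s] z_int(2)[OF t]]
      by (simp add: J_def)
    then show ?thesis by (simp add: max_def)
  qed
  have cont: "(\<lambda>n. J (s n)) \<longlonglongrightarrow> J t"
    if s: "\<And>n. s n \<in> fractions M" and t: "t \<in> fractions M"
      and lim: "AE \<omega> in M. (\<lambda>n::nat. s n \<omega>) \<longlonglongrightarrow> t \<omega>" for s t
    unfolding J_def
  proof (intro tendsto_add E1.overload_tendsto[where y=y] E2.overload_tendsto[where y=y]
      z_int s t y z_bound)
    show "AE \<omega> in M. (\<lambda>n. z1 (s n) \<omega>) \<longlonglongrightarrow> z1 t \<omega>"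
      using lim by eventually_elim (auto simp: z1_def intro!: tendsto_intros)
    show "AE \<omega> in M. (\<lambda>n. z2 (s n) \<omega>) \<longlonglongrightarrow> z2 t \<omega>"
      using lim by eventually_elim (auto simp: z2_def intro!: tendsto_intros)
  qed
  obtain \<theta> where \<theta>: "\<theta> \<in> fractions M" and minimal: "\<And>s. s \<in> fractions M \<Longrightarrow> J \<theta> \<le> J s"
  proof (rule fractions_minimizer[of J])
    show "0 \<le> J s" for s by (simp add: J_def E1.overload_nonneg E2.overload_nonneg)
  qed (use mid cont in blast)+
  have [measurable]: "\<theta> \<in> borel_measurable M" using \<theta> by (simp add: fractions_def)
  define f1 where "f1 = pressure M B1 (z1 \<theta>)"
  define f2 where "f2 = pressure M B2 (z2 \<theta>)"
  have f_meas: "f1 \<in> borel_measurable B1" "f2 \<in> borel_measurable B2"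
    unfolding f1_def f2_def by measurable
  have [measurable]: "f1 \<in> borel_measurable M" "f2 \<in> borel_measurable M"
    unfolding f1_def f2_def by measurable
  have f0: "0 \<le> f1 \<omega>" "0 \<le> f2 \<omega>" "f1 \<omega> \<le> 1" "f2 \<omega> \<le> 1" for \<omega>
    using huber_slope_bounds by (auto simp: f1_def f2_def)
  \<comment> \<open>The first variation of \<open>J\<close> towards \<open>s\<close>. The tangent inequality is applied at the moved
     points \<open>q n\<close>, where it bounds the increment of \<open>J\<close> from above; the step tends to zero only
     afterwards, so that no derivative of an integral is needed.\<close>
  have first_order: "0 \<le> (\<integral>\<omega>. (f1 \<omega> - f2 \<omega>) * ((s \<omega> - \<theta> \<omega>) * y \<omega>) \<partial>M)"
    if s: "s \<in> fractions M" for s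
  proof -
    have [measurable]: "s \<in> borel_measurable M" using s by (simp add: fractions_def)
    define t where "t n = 1 / real (Suc n)" for n
    define q where "q n \<omega> = \<theta> \<omega> + t n * (s \<omega> - \<theta> \<omega>)" for n \<omega>
    have t: "0 < t n" "t n \<le> 1" for n by (auto simp: t_def)
    have t_lim: "t \<longlonglongrightarrow> 0"
      unfolding t_def using LIMSEQ_inverse_real_of_nat by (simp add: inverse_eq_divide)
    have q: "q n \<in> fractions M" for n
    proof -
      have "0 \<le> q n \<omega> \<and> q n \<omega> \<le> 1" for \<omega>
      proof -
        have "q n \<omega> = (1 - t n) * \<theta> \<omega> + t n * s \<omega>" by (simp add: q_def algebra_simps)
        moreover have "(1 - t n) * \<theta> \<omega> + t n * s \<omega> \<le> (1 - t n) * 1 + t n * 1"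
          using t[of n] fractions_bounds[OF s] fractions_bounds[OF \<theta>]
          by (intro add_mono mult_left_mono) auto
        ultimately show ?thesis
          using t[of n] fractions_bounds[OF s] fractions_bounds[OF \<theta>] by simp
      qed
      then show ?thesis unfolding fractions_def q_def by simp
    qed
    define d where "d \<omega> = (s \<omega> - \<theta> \<omega>) * y \<omega>" for \<omega>
    have d_eq: "d = (\<lambda>\<omega>. z1 s \<omega> - z1 \<theta> \<omega>)" by (auto simp: d_def z1_def algebra_simps)
    have d: "integrable M d" unfolding d_eq using z_int[OF s] z_int[OF \<theta>] by simp
    have [measurable]: "d \<in> borel_measurable M" using d by auto
    have z1q: "z1 (q n) = (\<lambda>\<omega>. z1 \<theta> \<omega> + t n * d \<omega>)"
      and z2q: "z2 (q n) = (\<lambda>\<omega>. z2 \<theta> \<omega> - t n * d \<omega>)" for n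
      by (auto simp: z1_def z2_def q_def d_def algebra_simps)
    let ?p = "\<lambda>n \<omega>. pressure M B1 (z1 (q n)) \<omega> - pressure M B2 (z2 (q n)) \<omega>"
    have p_bound: "\<bar>?p n \<omega>\<bar> \<le> 1" for n \<omega>
      using huber_slope_bounds(1) huber_slope_bounds(2) by (smt (verit))
    have nonneg: "0 \<le> (\<integral>\<omega>. ?p n \<omega> * d \<omega> \<partial>M)" for n
    proof -
      note T1 = E1.overload_tangent[OF z_int(1)[OF \<theta>] z_int(1)[OF q, of n]]
      note T2 = E2.overload_tangent[OF z_int(2)[OF \<theta>] z_int(2)[OF q, of n]]
      have "0 \<le> J (q n) - J \<theta>" using minimal[OF q] by simp
      also have "\<dots> \<le> (\<integral>\<omega>. pressure M B1 (z1 (q n)) \<omega> * (z1 (q n) \<omega> - z1 \<theta> \<omega>) \<partial>M)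
          + (\<integral>\<omega>. pressure M B2 (z2 (q n)) \<omega> * (z2 (q n) \<omega> - z2 \<theta> \<omega>) \<partial>M)"
        using T1(2) T2(2) by (simp add: J_def)
      also have "\<dots> = (\<integral>\<omega>. pressure M B1 (z1 (q n)) \<omega> * (z1 (q n) \<omega> - z1 \<theta> \<omega>)
          + pressure M B2 (z2 (q n)) \<omega> * (z2 (q n) \<omega> - z2 \<theta> \<omega>) \<partial>M)"
        using T1(1) T2(1) by simp
      also have "\<dots> = (\<integral>\<omega>. t n * (?p n \<omega> * d \<omega>) \<partial>M)"
        by (intro Bochner_Integration.integral_cong) (auto simp: z1q z2q algebra_simps)
      also have "\<dots> = t n * (\<integral>\<omega>. ?p n \<omega> * d \<omega> \<partial>M)" by simp
      finally show ?thesis using t[of n] by (simp add: zero_le_mult_iff)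
    qed
    have lim1: "AE \<omega> in M. (\<lambda>n. pressure M B1 (z1 (q n)) \<omega>) \<longlonglongrightarrow> f1 \<omega>"
    proof -
      have "AE \<omega> in M. \<forall>n. real_cond_exp M B1 (z1 (q n)) \<omega>
          = real_cond_exp M B1 (z1 \<theta>) \<omega> + t n * real_cond_exp M B1 d \<omega>"
        unfolding AE_all_countable
      proof
        fix n
        have "AE \<omega> in M. real_cond_exp M B1 (\<lambda>\<omega>. z1 \<theta> \<omega> + t n * d \<omega>) \<omega>
            = real_cond_exp M B1 (z1 \<theta>) \<omega> + real_cond_exp M B1 (\<lambda>\<omega>. t n * d \<omega>) \<omega>"
          using z_int[OF \<theta>] d by (intro E1.real_cond_exp_add) auto
        then show "AE \<omega> in M. real_cond_exp M B1 (z1 (q n)) \<omega>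
            = real_cond_exp M B1 (z1 \<theta>) \<omega> + t n * real_cond_exp M B1 d \<omega>"
          using E1.real_cond_exp_cmult[OF d, of "t n"] unfolding z1q by eventually_elim simp
      qed
      then show ?thesis
      proof eventually_elim
        case (elim \<omega>)
        have "(\<lambda>n. real_cond_exp M B1 (z1 (q n)) \<omega>)
            \<longlonglongrightarrow> real_cond_exp M B1 (z1 \<theta>) \<omega> + 0 * real_cond_exp M B1 d \<omega>"
          unfolding elim[rule_format] by (intro tendsto_intros t_lim)
        then show ?case
          unfolding f1_def by (intro isCont_tendsto_compose[OF huber_slope_isCont]) simp
      qed
    qed
    have lim2: "AE \<omega> in M. (\<lambda>n. pressure M B2 (z2 (q n)) \<omega>) \<longlonglongrightarrow> f2 \<omega>"
    proof -
      have "AE \<omega> in M. \<forall>n. real_cond_exp M B2 (z2 (q n)) \<omega>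
          = real_cond_exp M B2 (z2 \<theta>) \<omega> - t n * real_cond_exp M B2 d \<omega>"
        unfolding AE_all_countable
      proof
        fix n
        have "AE \<omega> in M. real_cond_exp M B2 (\<lambda>\<omega>. z2 \<theta> \<omega> - t n * d \<omega>) \<omega>
            = real_cond_exp M B2 (z2 \<theta>) \<omega> - real_cond_exp M B2 (\<lambda>\<omega>. t n * d \<omega>) \<omega>"
          using z_int[OF \<theta>] d by (intro E2.real_cond_exp_diff) auto
        then show "AE \<omega> in M. real_cond_exp M B2 (z2 (q n)) \<omega>
            = real_cond_exp M B2 (z2 \<theta>) \<omega> - t n * real_cond_exp M B2 d \<omega>"
          using E2.real_cond_exp_cmult[OF d, of "t n"] unfolding z2q by eventually_elim simp
      qed
      then show ?thesis
      proof eventually_elim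
        case (elim \<omega>)
        have "(\<lambda>n. real_cond_exp M B2 (z2 (q n)) \<omega>)
            \<longlonglongrightarrow> real_cond_exp M B2 (z2 \<theta>) \<omega> - 0 * real_cond_exp M B2 d \<omega>"
          unfolding elim[rule_format] by (intro tendsto_intros t_lim)
        then show ?case
          unfolding f2_def by (intro isCont_tendsto_compose[OF huber_slope_isCont]) simp
      qed
    qed
    have "(\<lambda>n. \<integral>\<omega>. ?p n \<omega> * d \<omega> \<partial>M) \<longlonglongrightarrow> (\<integral>\<omega>. (f1 \<omega> - f2 \<omega>) * d \<omega> \<partial>M)"
    proof (rule integral_dominated_convergence[where w="\<lambda>\<omega>. \<bar>d \<omega>\<bar>"])
      show "AE \<omega> in M. (\<lambda>n. ?p n \<omega> * d \<omega>) \<longlonglongrightarrow> (f1 \<omega> - f2 \<omega>) * d \<omega>"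
        using lim1 lim2 by eventually_elim (intro tendsto_intros)
      show "AE \<omega> in M. norm (?p n \<omega> * d \<omega>) \<le> \<bar>d \<omega>\<bar>" for n
        using p_bound by (auto simp: abs_mult intro!: mult_left_le_one_le)
    qed (use d in auto)
    then have "0 \<le> (\<integral>\<omega>. (f1 \<omega> - f2 \<omega>) * d \<omega> \<partial>M)"
      by (rule LIMSEQ_le_const) (use nonneg in auto)
    then show ?thesis by (simp add: d_def)
  qed
  have f_int: "integrable M f1" "integrable M f2"
    using f0 by (auto intro!: integrable_const_bound[where B=1])
  have fz_int: "integrable M (\<lambda>\<omega>. f1 \<omega> * z1 \<theta> \<omega>)" "integrable M (\<lambda>\<omega>. f2 \<omega> * z2 \<theta> \<omega>)"
  proof -
    have "integrable M (\<lambda>\<omega>. f \<omega> * z \<omega>)"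
      if [measurable]: "f \<in> borel_measurable M" and "\<And>\<omega>. 0 \<le> f \<omega>" "\<And>\<omega>. f \<omega> \<le> 1" and z: "integrable M z"
      for f z :: "'a \<Rightarrow> real"
      using that by (intro Bochner_Integration.integrable_bound[OF z])
        (auto simp: abs_mult mult_left_le_one_le)
    then show "integrable M (\<lambda>\<omega>. f1 \<omega> * z1 \<theta> \<omega>)" "integrable M (\<lambda>\<omega>. f2 \<omega> * z2 \<theta> \<omega>)"
      using f0 z_int[OF \<theta>] by auto
  qed
  note u1 = E1.real_cond_exp_intg[OF fz_int(1) f_meas(1)]
  note u2 = E2.real_cond_exp_intg[OF fz_int(2) f_meas(2)]
  have ymin_int: "integrable M (\<lambda>\<omega>. y \<omega> * min (f1 \<omega>) (f2 \<omega>))"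
  proof (rule Bochner_Integration.integrable_bound[OF y])
    have "0 \<le> min (f1 \<omega>) (f2 \<omega>) \<and> min (f1 \<omega>) (f2 \<omega>) \<le> 1" for \<omega>
      using f0 by (simp add: min_le_iff_disj)
    then show "AE \<omega> in M. norm (y \<omega> * min (f1 \<omega>) (f2 \<omega>)) \<le> norm (y \<omega>)"
      using y0 by (auto simp del: min_less_iff_conj simp: abs_mult intro!: mult_right_le_one_le)
  qed measurable
  \<comment> \<open>Sends all mass to the side of smaller pressure: its pointwise cost is \<open>min (f1 \<omega>) (f2 \<omega>)\<close>.\<close>
  let ?s = "\<lambda>\<omega>. if f1 \<omega> < f2 \<omega> then 1 else 0 :: real"
  have upper: "(\<integral>\<omega>. f1 \<omega> * z1 \<theta> \<omega> \<partial>M) + (\<integral>\<omega>. f2 \<omega> * z2 \<theta> \<omega> \<partial>M)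
      \<le> (\<integral>\<omega>. y \<omega> * min (f1 \<omega>) (f2 \<omega>) \<partial>M)"
  proof -
    have s: "?s \<in> fractions M" unfolding fractions_def by auto
    have "(\<integral>\<omega>. (f1 \<omega> - f2 \<omega>) * ((?s \<omega> - \<theta> \<omega>) * y \<omega>) \<partial>M)
        = (\<integral>\<omega>. y \<omega> * min (f1 \<omega>) (f2 \<omega>) - (f1 \<omega> * z1 \<theta> \<omega> + f2 \<omega> * z2 \<theta> \<omega>) \<partial>M)"
      by (intro Bochner_Integration.integral_cong) (auto simp: z1_def z2_def min_def algebra_simps)
    also have "\<dots> = (\<integral>\<omega>. y \<omega> * min (f1 \<omega>) (f2 \<omega>) \<partial>M)
        - ((\<integral>\<omega>. f1 \<omega> * z1 \<theta> \<omega> \<partial>M) + (\<integral>\<omega>. f2 \<omega> * z2 \<theta> \<omega> \<partial>M))"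
      using ymin_int fz_int by simp
    finally show ?thesis using first_order[OF s] by simp
  qed
  have lower: "(\<integral>\<omega>. y \<omega> * min (f1 \<omega>) (f2 \<omega>) \<partial>M) \<le> (\<integral>\<omega>. f1 \<omega> \<partial>M) + (\<integral>\<omega>. f2 \<omega> \<partial>M)"
  proof -
    have "ennreal (\<integral>\<omega>. y \<omega> * min (f1 \<omega>) (f2 \<omega>) \<partial>M) = (\<integral>\<^sup>+\<omega>. ennreal (y \<omega> * min (f1 \<omega>) (f2 \<omega>)) \<partial>M)"
      using f0 y0 by (intro nn_integral_eq_integral[symmetric] ymin_int) auto
    also have "\<dots> \<le> (\<integral>\<^sup>+\<omega>. ennreal (f1 \<omega>) \<partial>M) + (\<integral>\<^sup>+\<omega>. ennreal (f2 \<omega>) \<partial>M)"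
      using sub y0 cond f_meas f0 by (intro intersection_condition_layer_cake) auto
    also have "\<dots> = ennreal ((\<integral>\<omega>. f1 \<omega> \<partial>M) + (\<integral>\<omega>. f2 \<omega> \<partial>M))"
      using f0 f_int by (simp add: nn_integral_eq_integral)
    finally show ?thesis
      using f0 by (subst (asm) ennreal_le_iff) (auto intro!: add_nonneg_nonneg integral_nonneg_AE)
  qed
  have e0: "0 \<le> huber_slope u * (u - 1)" for u
    by (cases "1 \<le> u") (auto simp: huber_slope_def max_def)
  have e_zero: "u \<le> 1" if "huber_slope u * (u - 1) = 0" for u
    using that by (auto simp: huber_slope_def max_def min_def split: if_splits)
  define e1 where "e1 \<omega> = f1 \<omega> * (real_cond_exp M B1 (z1 \<theta>) \<omega> - 1)" for \<omega>
  define e2 where "e2 \<omega> = f2 \<omega> * (real_cond_exp M B2 (z2 \<theta>) \<omega> - 1)" for \<omega>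
  have e_nonneg: "0 \<le> e1 \<omega>" "0 \<le> e2 \<omega>" for \<omega>
    by (auto simp: e1_def e2_def f1_def f2_def e0)
  have e_int: "integrable M e1" "integrable M e2"
    unfolding e1_def e2_def right_diff_distrib using u1(1) u2(1) f_int z_int[OF \<theta>] by auto
  have "(\<integral>\<omega>. e1 \<omega> + e2 \<omega> \<partial>M) = (\<integral>\<omega>. f1 \<omega> * z1 \<theta> \<omega> \<partial>M) + (\<integral>\<omega>. f2 \<omega> * z2 \<theta> \<omega> \<partial>M)
      - ((\<integral>\<omega>. f1 \<omega> \<partial>M) + (\<integral>\<omega>. f2 \<omega> \<partial>M))"
  proof -
    have "(\<integral>\<omega>. e1 \<omega> \<partial>M) = (\<integral>\<omega>. f1 \<omega> * z1 \<theta> \<omega> \<partial>M) - (\<integral>\<omega>. f1 \<omega> \<partial>M)"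
      "(\<integral>\<omega>. e2 \<omega> \<partial>M) = (\<integral>\<omega>. f2 \<omega> * z2 \<theta> \<omega> \<partial>M) - (\<integral>\<omega>. f2 \<omega> \<partial>M)"
      unfolding e1_def e2_def right_diff_distrib using u1 u2 f_int z_int[OF \<theta>] by auto
    then show ?thesis using e_int by simp
  qed
  then have "(\<integral>\<omega>. e1 \<omega> + e2 \<omega> \<partial>M) \<le> 0" using upper lower by linarith
  moreover have "0 \<le> (\<integral>\<omega>. e1 \<omega> + e2 \<omega> \<partial>M)" using e_nonneg by (intro integral_nonneg_AE) auto
  ultimately have "(\<integral>\<omega>. e1 \<omega> + e2 \<omega> \<partial>M) = 0" by linarith
  then have zero: "AE \<omega> in M. e1 \<omega> + e2 \<omega> = 0"
    using e_int e_nonneg by (subst (asm) integral_nonneg_eq_0_iff_AE) auto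
  have "AE \<omega> in M. real_cond_exp M B1 (z1 \<theta>) \<omega> \<le> 1"
    using zero
  proof eventually_elim
    case (elim \<omega>)
    then have "e1 \<omega> = 0" using e_nonneg[of \<omega>] by linarith
    then show ?case by (intro e_zero) (simp add: e1_def f1_def)
  qed
  moreover have "AE \<omega> in M. real_cond_exp M B2 (z2 \<theta>) \<omega> \<le> 1"
    using zero
  proof eventually_elim
    case (elim \<omega>)
    then have "e2 \<omega> = 0" using e_nonneg[of \<omega>] by linarith
    then show ?case by (intro e_zero) (simp add: e2_def f2_def)
  qed
  ultimately show ?thesis
    using that[OF \<theta>] unfolding z1_def z2_def by blast
qed

section \<open>The norms and the intersection condition\<close>

context finite_measure_subalgebra
begin

lemma set_nn_integral_le_C_norm:
  fixes x :: "'a \<Rightarrow> 'b::{real_normed_field, euclidean_space}"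
  assumes [measurable]: "x \<in> borel_measurable M"
    and norm: "C_norm M F x \<le> ereal c" and c: "0 \<le> c" and E: "E \<in> sets F"
  shows "(\<integral>\<^sup>+\<omega>\<in>E. ennreal (norm (x \<omega>)) \<partial>M) \<le> ennreal c * emeasure M E"
proof -
  have EM[measurable]: "E \<in> sets M" using E subalg by (auto simp: subalgebra_def)
  let ?u = "real_cond_exp M F (\<lambda>\<omega>. norm (x \<omega>))"
  have int: "integrable M (\<lambda>\<omega>. norm (x \<omega>))"
    using norm by (auto simp: C_norm_def split: if_splits)
  have int': "integrable M (\<lambda>\<omega>. indicator E \<omega> * norm (x \<omega>))"
    using integrable_mult_indicator[OF EM int] by simp
  note I = real_cond_exp_intg[OF int']
  have bound: "AE \<omega> in M. ?u \<omega> \<le> c"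
  proof -
    have "AE \<omega> in M. ereal \<bar>?u \<omega>\<bar> \<le> esssup M (\<lambda>\<omega>. ereal \<bar>?u \<omega>\<bar>)" by (rule esssup_AE)
    then show ?thesis
    proof eventually_elim
      case (elim \<omega>)
      also have "esssup M (\<lambda>\<omega>. ereal \<bar>?u \<omega>\<bar>) \<le> ereal c"
        using norm int by (simp add: C_norm_def Linf_norm_def)
      finally show ?case by simp
    qed
  qed
  have "(\<integral>\<^sup>+\<omega>\<in>E. ennreal (norm (x \<omega>)) \<partial>M) = (\<integral>\<^sup>+\<omega>. ennreal (indicator E \<omega> * norm (x \<omega>)) \<partial>M)"
    by (intro nn_integral_cong) (auto simp: indicator_def)
  also have "\<dots> = ennreal (\<integral>\<omega>. indicator E \<omega> * norm (x \<omega>) \<partial>M)"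
    by (intro nn_integral_eq_integral int') auto
  also have "\<dots> = ennreal (\<integral>\<omega>. indicator E \<omega> * ?u \<omega> \<partial>M)"
    using I(2) E by simp
  also have "\<dots> \<le> ennreal (\<integral>\<omega>. indicator E \<omega> * c \<partial>M)"
  proof (intro ennreal_leI integral_mono_AE)
    show "AE \<omega> in M. indicator E \<omega> * ?u \<omega> \<le> indicator E \<omega> * c"
      using bound by eventually_elim (auto simp: indicator_def)
  qed (use I(1) E in \<open>auto simp: emeasure_eq_measure\<close>)
  also have "\<dots> = ennreal c * emeasure M E"
    using c by (simp add: emeasure_eq_measure ennreal_mult'[symmetric] mult.commute)
  finally show ?thesis .
qed

lemma C_norm_nonneg:
  fixes x :: "'a \<Rightarrow> 'b::{real_normed_field, euclidean_space}"
  assumes "emeasure M (space M) \<noteq> 0"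
  shows "0 \<le> C_norm M F x"
proof -
  have "esssup M (\<lambda>_. 0 :: ereal) \<le> Linf_norm M (real_cond_exp M F (\<lambda>\<omega>. norm (x \<omega>)))"
    unfolding Linf_norm_def by (rule esssup_mono) auto
  then show ?thesis using assms by (auto simp: C_norm_def esssup_const)
qed

lemma C_norm_le_1I:
  assumes "integrable M (\<lambda>\<omega>. norm (x \<omega>))"
    and "AE \<omega> in M. real_cond_exp M F (\<lambda>\<omega>. norm (x \<omega>)) \<omega> \<le> 1"
  shows "C_norm M F x \<le> 1"
proof -
  have "AE \<omega> in M. 0 \<le> real_cond_exp M F (\<lambda>\<omega>. norm (x \<omega>)) \<omega>"
    using assms(1) by (intro real_cond_exp_pos) auto
  with assms(2) have "AE \<omega> in M. ereal \<bar>real_cond_exp M F (\<lambda>\<omega>. norm (x \<omega>)) \<omega>\<bar> \<le> 1"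
    by eventually_elim simp
  then show ?thesis
    using assms(1) by (auto simp: C_norm_def Linf_norm_def intro!: esssup_I)
qed

end

text \<open>
  The infimum defining the norm of the sum need not be attained, so the inequality is proved with
  $1 + e$ in place of $1$, and $e$ tends to zero.
\<close>

lemma (in prob_space) C_sum_norm_imp_intersection_condition:
  fixes x :: "'a \<Rightarrow> 'b::{real_normed_field, euclidean_space}"
  assumes sub: "subalgebra M B1" "subalgebra M B2"
    and [measurable]: "x \<in> borel_measurable M"
    and norm: "C_sum_norm M B1 B2 x \<le> 1"
  shows "intersection_condition M B1 B2 x"
  unfolding intersection_condition_def
proof (intro ballI)
  fix A1 A2 assume A: "A1 \<in> sets B1" "A2 \<in> sets B2"
  interpret E1: finite_measure_subalgebra M B1 using sub(1) by unfold_locales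
  interpret E2: finite_measure_subalgebra M B2 using sub(2) by unfold_locales
  have [measurable]: "A1 \<in> sets M" "A2 \<in> sets M" using A sub by (auto simp: subalgebra_def)
  have ne: "emeasure M (space M) \<noteq> 0" by (simp add: emeasure_space_1)
  have eps: "(\<integral>\<^sup>+\<omega>\<in>A1 \<inter> A2. ennreal (norm (x \<omega>)) \<partial>M) \<le> ennreal (1 + e) * (emeasure M A1 + emeasure M A2)"
    if "0 < e" for e :: real
  proof -
    have "C_sum_norm M B1 B2 x < ereal (1 + e)"
      using norm that by (rule_tac order_le_less_trans) auto
    then obtain x1 x2 where dec: "(x1, x2) \<in> C_decomps M B1 B2 x"
      and less: "C_norm M B1 x1 + C_norm M B2 x2 < ereal (1 + e)"
      by (auto simp: C_sum_norm_def INF_less_iff)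
    have [measurable]: "x1 \<in> borel_measurable M" "x2 \<in> borel_measurable M"
      and eq: "AE \<omega> in M. x \<omega> = x1 \<omega> + x2 \<omega>"
      using dec by (auto simp: C_decomps_def C_space_def)
    have pos: "0 \<le> C_norm M B1 x1" "0 \<le> C_norm M B2 x2"
      using E1.C_norm_nonneg[OF ne] E2.C_norm_nonneg[OF ne] by auto
    have le: "C_norm M B1 x1 \<le> ereal (1 + e)" "C_norm M B2 x2 \<le> ereal (1 + e)"
      using less pos add_increasing2[OF pos(2) order_refl, of "C_norm M B1 x1"]
        add_increasing[OF pos(1) order_refl, of "C_norm M B2 x2"]
      by (meson order_trans less_imp_le)+
    have "(\<integral>\<^sup>+\<omega>\<in>A1 \<inter> A2. ennreal (norm (x \<omega>)) \<partial>M)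
        \<le> (\<integral>\<^sup>+\<omega>. ennreal (norm (x1 \<omega>)) * indicator A1 \<omega> + ennreal (norm (x2 \<omega>)) * indicator A2 \<omega> \<partial>M)"
    proof (rule nn_integral_mono_AE)
      show "AE \<omega> in M. ennreal (norm (x \<omega>)) * indicator (A1 \<inter> A2) \<omega>
          \<le> ennreal (norm (x1 \<omega>)) * indicator A1 \<omega> + ennreal (norm (x2 \<omega>)) * indicator A2 \<omega>"
        using eq
      proof eventually_elim
        case (elim \<omega>)
        then show ?case
          by (auto simp: indicator_def norm_triangle_ineq ennreal_plus[symmetric] simp del: ennreal_plus)
      qed
    qed
    also have "\<dots> = (\<integral>\<^sup>+\<omega>\<in>A1. ennreal (norm (x1 \<omega>)) \<partial>M) + (\<integral>\<^sup>+\<omega>\<in>A2. ennreal (norm (x2 \<omega>)) \<partial>M)"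
      by (rule nn_integral_add) measurable
    also have "\<dots> \<le> ennreal (1 + e) * emeasure M A1 + ennreal (1 + e) * emeasure M A2"
      using le A that
      by (intro add_mono E1.set_nn_integral_le_C_norm E2.set_nn_integral_le_C_norm) auto
    finally show ?thesis by (simp add: distrib_left)
  qed
  define a where "a = measure M A1 + measure M A2"
  have a: "emeasure M A1 + emeasure M A2 = ennreal a" "0 \<le> a"
    by (auto simp: a_def emeasure_eq_measure)
  have bound: "(\<integral>\<^sup>+\<omega>\<in>A1 \<inter> A2. ennreal (norm (x \<omega>)) \<partial>M) \<le> ennreal ((1 + 1 / real (Suc n)) * a)" for n
    using eps[of "1 / real (Suc n)"] a by (simp add: ennreal_mult'')
  have "(\<lambda>n. ennreal ((1 + inverse (real (Suc n))) * a)) \<longlonglongrightarrow> ennreal (1 * a)"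
    by (intro tendsto_ennrealI tendsto_mult_right LIMSEQ_inverse_real_of_nat_add)
  then have "(\<integral>\<^sup>+\<omega>\<in>A1 \<inter> A2. ennreal (norm (x \<omega>)) \<partial>M) \<le> ennreal (1 * a)"
    using bound by (intro LIMSEQ_le_const) (auto simp: inverse_eq_divide)
  then show "(\<integral>\<^sup>+\<omega>\<in>A1 \<inter> A2. ennreal (norm (x \<omega>)) \<partial>M) \<le> emeasure M A1 + emeasure M A2"
    unfolding a by simp
qed

text \<open>
  The condition for the whole space makes $x$ integrable, so the splitting of $|x|$ applies.
\<close>

lemma (in prob_space) intersection_condition_imp_C_sum_norm:
  fixes x :: "'a \<Rightarrow> 'b::{real_normed_field, euclidean_space}"
  assumes sub: "subalgebra M B1" "subalgebra M B2"
    and [measurable]: "x \<in> borel_measurable M"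
    and cond: "intersection_condition M B1 B2 x"
  shows "x \<in> C_sum M B1 B2 \<and> C_sum_norm M B1 B2 x \<le> 2"
proof -
  interpret E1: finite_measure_subalgebra M B1 using sub(1) by unfold_locales
  interpret E2: finite_measure_subalgebra M B2 using sub(2) by unfold_locales
  let ?y = "\<lambda>\<omega>. norm (x \<omega>)"
  have int: "integrable M ?y"
  proof (rule integrableI_bounded)
    have sp: "space M \<in> sets B1" "space M \<in> sets B2"
      using sub by (metis subalgebra_def sets.top)+
    have "(\<integral>\<^sup>+\<omega>. ennreal (norm (norm (x \<omega>))) \<partial>M)
        = (\<integral>\<^sup>+\<omega>\<in>space M \<inter> space M. ennreal (norm (x \<omega>)) \<partial>M)"
      by (intro nn_integral_cong) (auto simp: indicator_def)
    also have "\<dots> \<le> emeasure M (space M) + emeasure M (space M)"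
      using cond sp unfolding intersection_condition_def by blast
    also have "\<dots> < \<infinity>" by (simp add: emeasure_space_1)
    finally show "(\<integral>\<^sup>+\<omega>. ennreal (norm (norm (x \<omega>))) \<partial>M) < \<infinity>" .
  qed auto
  have "intersection_condition M B1 B2 ?y"
    using cond by (simp add: intersection_condition_def)
  then obtain \<theta> where \<theta>: "\<theta> \<in> fractions M"
    and b1: "AE \<omega> in M. real_cond_exp M B1 (\<lambda>\<omega>. \<theta> \<omega> * ?y \<omega>) \<omega> \<le> 1"
    and b2: "AE \<omega> in M. real_cond_exp M B2 (\<lambda>\<omega>. (1 - \<theta> \<omega>) * ?y \<omega>) \<omega> \<le> 1"
    using balanced_splitting[OF sub int] by auto
  have [measurable]: "\<theta> \<in> borel_measurable M" using \<theta> by (simp add: fractions_def)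
  let ?x1 = "\<lambda>\<omega>. \<theta> \<omega> *\<^sub>R x \<omega>" and ?x2 = "\<lambda>\<omega>. (1 - \<theta> \<omega>) *\<^sub>R x \<omega>"
  have n: "norm (?x1 \<omega>) = \<theta> \<omega> * ?y \<omega>" "norm (?x2 \<omega>) = (1 - \<theta> \<omega>) * ?y \<omega>" for \<omega>
    using fractions_bounds[OF \<theta>, of \<omega>] by auto
  have "integrable M (\<lambda>\<omega>. norm (?x1 \<omega>))" "integrable M (\<lambda>\<omega>. norm (?x2 \<omega>))"
    using fractions_bounds[OF \<theta>]
    by (auto intro!: Bochner_Integration.integrable_bound[OF int] simp: abs_mult mult_left_le_one_le)
  then have C: "C_norm M B1 ?x1 \<le> 1" "C_norm M B2 ?x2 \<le> 1"
    using b1 b2 by (auto intro!: E1.C_norm_le_1I E2.C_norm_le_1I simp only: n)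
  have dec: "(?x1, ?x2) \<in> C_decomps M B1 B2 x"
    using C by (auto simp: C_decomps_def C_space_def scaleR_left_distrib[symmetric]
        intro: order_le_less_trans)
  have "C_sum_norm M B1 B2 x \<le> C_norm M B1 ?x1 + C_norm M B2 ?x2"
    unfolding C_sum_norm_def by (rule INF_lower2[OF dec]) simp
  also have "\<dots> \<le> 1 + 1" using C by (rule add_mono)
  finally show ?thesis using dec by (auto simp: C_sum_def)
qed

(* The scalar field 'b is the reals or the complex numbers: up to isomorphism these are the only
   types in both classes real_normed_field and euclidean_space. *)
theorem mainTheorem4:
  fixes M B1 B2 :: "'a measure"
    and x :: "'a \<Rightarrow> 'b::{real_normed_field, euclidean_space}"
  assumes "prob_space M"
    and "subalgebra M B1"
    and "subalgebra M B2"
    and "x \<in> borel_measurable M"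
  shows "(x \<in> C_sum M B1 B2 \<and> C_sum_norm M B1 B2 x \<le> 1 \<longrightarrow> intersection_condition M B1 B2 x)
       \<and> (intersection_condition M B1 B2 x \<longrightarrow> x \<in> C_sum M B1 B2 \<and> C_sum_norm M B1 B2 x \<le> 2)"
proof -
  interpret prob_space M by fact
  show ?thesis
    using C_sum_norm_imp_intersection_condition intersection_condition_imp_C_sum_norm assms by blast
qed

end
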